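(* There is a finite semilattice $L$ such that $g_L(n)=\Omega(n)$.
   Context: A semilattice $L$ (a finite meet-semilattice) is regarded as an algebra with the two binary operations $\wedge$ and $\sqcup$. Here $a\sqcup b=a\vee b$ if the join $a\vee b$ exists, and $a\sqcup b=a\wedge b$ otherwise. The $n$-fold power $L^n$ is the algebra on $L^n$ with both operations applied componentwise. A subalgebra of $L^n$ is a subset $B$ closed under both operations. A generating set of $B$ is a subset $G\subseteq B$ such that every element of $B$ is obtained from elements of $G$ by iteratively applying the operations. $g_L^B(n)$ is the minimum cardinality of a generating set of $B$, and $g_L(n)=\max_B g_L^B(n)$ over all subalgebras $B$ of $L^n$. *)

theory Defs
  imports "HOL-Algebra.Lattice" "HOL-Library.Landau_Symbols"
begin

definition finite_semilattice :: "('a, 'm) gorder_scheme \<Rightarrow> bool" where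
  "finite_semilattice L \<longleftrightarrow> lower_semilattice L \<and> finite (carrier L) \<and> carrier L \<noteq> {}"

definition sqjoin :: "('a, 'm) gorder_scheme \<Rightarrow> 'a \<Rightarrow> 'a \<Rightarrow> 'a" where
  "sqjoin L a b =
     (if \<exists>s. least L s (Upper L {a, b}) then a \<squnion>\<^bsub>L\<^esub> b else a \<sqinter>\<^bsub>L\<^esub> b)"

text \<open>Elements of the \<open>n\<close>-fold power are extensional functions on \<open>{..<n}\<close>
  (equal to \<^const>\<open>undefined\<close> elsewhere), so that there is exactly one function per \<open>n\<close>-tuple.\<close>

definition power_carrier :: "('a, 'm) gorder_scheme \<Rightarrow> nat \<Rightarrow> (nat \<Rightarrow> 'a) set" where
  "power_carrier L n = {..<n} \<rightarrow>\<^sub>E carrier L"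

definition power_meet ::
  "('a, 'm) gorder_scheme \<Rightarrow> nat \<Rightarrow> (nat \<Rightarrow> 'a) \<Rightarrow> (nat \<Rightarrow> 'a) \<Rightarrow> (nat \<Rightarrow> 'a)" where
  "power_meet L n x y = (\<lambda>i\<in>{..<n}. x i \<sqinter>\<^bsub>L\<^esub> y i)"

definition power_sqjoin ::
  "('a, 'm) gorder_scheme \<Rightarrow> nat \<Rightarrow> (nat \<Rightarrow> 'a) \<Rightarrow> (nat \<Rightarrow> 'a) \<Rightarrow> (nat \<Rightarrow> 'a)" where
  "power_sqjoin L n x y = (\<lambda>i\<in>{..<n}. sqjoin L (x i) (y i))"

definition subalgebra :: "('a, 'm) gorder_scheme \<Rightarrow> nat \<Rightarrow> (nat \<Rightarrow> 'a) set \<Rightarrow> bool" where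
  "subalgebra L n B \<longleftrightarrow>
     B \<subseteq> power_carrier L n \<and>
     (\<forall>x\<in>B. \<forall>y\<in>B. power_meet L n x y \<in> B \<and> power_sqjoin L n x y \<in> B)"

inductive_set generated ::
  "('a, 'm) gorder_scheme \<Rightarrow> nat \<Rightarrow> (nat \<Rightarrow> 'a) set \<Rightarrow> (nat \<Rightarrow> 'a) set"
  for L n G where
  base: "x \<in> G \<Longrightarrow> x \<in> generated L n G"
| meet: "\<lbrakk>x \<in> generated L n G; y \<in> generated L n G\<rbrakk> \<Longrightarrow> power_meet L n x y \<in> generated L n G"
| sqjoin: "\<lbrakk>x \<in> generated L n G; y \<in> generated L n G\<rbrakk> \<Longrightarrow> power_sqjoin L n x y \<in> generated L n G"

definition generating_set ::
  "('a, 'm) gorder_scheme \<Rightarrow> nat \<Rightarrow> (nat \<Rightarrow> 'a) set \<Rightarrow> (nat \<Rightarrow> 'a) set \<Rightarrow> bool" where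
  "generating_set L n B G \<longleftrightarrow> G \<subseteq> B \<and> B \<subseteq> generated L n G"

text \<open>For a finite semilattice \<open>L\<close> the power is finite, so the sets below are
  finite and nonempty and \<^const>\<open>Min\<close> and \<^const>\<open>Max\<close> are the genuine minimum and maximum.\<close>

definition min_gen :: "('a, 'm) gorder_scheme \<Rightarrow> nat \<Rightarrow> (nat \<Rightarrow> 'a) set \<Rightarrow> nat" where
  "min_gen L n B = Min {card G | G. generating_set L n B G}"

definition max_gen :: "('a, 'm) gorder_scheme \<Rightarrow> nat \<Rightarrow> nat" where
  "max_gen L n = Max {min_gen L n B | B. subalgebra L n B}"

end

theory Submission
  imports Defs
begin

text \<open>In a set of pairwise comparable elements of \<open>L\<^sup>n\<close> both operations always return one of
  their arguments. Hence every subset of such a chain is a subalgebra, and the only generating set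
  of the chain is the chain itself. Already for the two-element semilattice, \<open>L\<^sup>n\<close> contains a
  chain with \<open>n + 1\<close> elements.\<close>

context partial_order
begin

text \<open>The equivalence for arbitrary \<open>s\<close> lets simp settle both the existence test
  in \<open>sqjoin\<close> and the choice operator hidden in \<open>join\<close>; the next lemma
  does the same for \<open>meet\<close>.\<close>

lemma least_Upper_pair:
  assumes "x \<in> carrier L" "y \<in> carrier L" "x \<sqsubseteq> y"
  shows "least L s (Upper L {x, y}) \<longleftrightarrow> s = y"
proof -
  have "least L y (Upper L {x, y})"
    by (rule least_UpperI) (use assms in auto)
  then show ?thesis
    using least_unique by blast
qed

lemma greatest_Lower_pair:
  assumes "x \<in> carrier L" "y \<in> carrier L" "x \<sqsubseteq> y"
  shows "greatest L s (Lower L {x, y}) \<longleftrightarrow> s = x"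
proof -
  have "greatest L x (Lower L {x, y})"
    by (rule greatest_LowerI) (use assms in auto)
  then show ?thesis
    using greatest_unique by blast
qed

lemma meet_eq_lesser:
  assumes "x \<in> carrier L" "y \<in> carrier L" "x \<sqsubseteq> y"
  shows "x \<sqinter> y = x" and "y \<sqinter> x = x"
  using greatest_Lower_pair[OF assms] by (simp_all add: meet_def inf_def insert_commute)

lemma sqjoin_eq_greater:
  assumes "x \<in> carrier L" "y \<in> carrier L" "x \<sqsubseteq> y"
  shows "sqjoin L x y = y" and "sqjoin L y x = y"
  using least_Upper_pair[OF assms] by (simp_all add: sqjoin_def join_def sup_def insert_commute)

lemma power_ops_comparable:
  assumes "x \<in> power_carrier L n" "y \<in> power_carrier L n" "\<And>i. i < n \<Longrightarrow> x i \<sqsubseteq> y i"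
  shows "power_meet L n x y = x" "power_meet L n y x = x"
    and "power_sqjoin L n x y = y" "power_sqjoin L n y x = y"
proof -
  have C: "x i \<in> carrier L" "y i \<in> carrier L" if "i < n" for i
    using assms(1,2) that by (auto simp: power_carrier_def)
  \<comment> \<open>Equality of tuples is equality of total functions. Off \<open>{..<n}\<close> the
    operations return \<open>undefined\<close>, and so must \<open>x\<close> and
    \<open>y\<close>.\<close>
  have E: "x i = undefined" "y i = undefined" if "\<not> i < n" for i
    using assms(1,2) that unfolding power_carrier_def by (metis PiE_arb lessThan_iff)+
  show "power_meet L n x y = x" "power_meet L n y x = x"
    "power_sqjoin L n x y = y" "power_sqjoin L n y x = y"
    using C E assms(3)
    by (auto simp: power_meet_def power_sqjoin_def meet_eq_lesser sqjoin_eq_greater fun_eq_iff)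
qed

text \<open>The disjunction stands outside the quantifier over \<open>i\<close>: if the direction
  could vary with the coordinate, an operation could mix coordinates of both arguments and leave the
  set.\<close>

definition power_chain :: "nat \<Rightarrow> (nat \<Rightarrow> 'a) set \<Rightarrow> bool" where
  "power_chain n B \<longleftrightarrow> B \<subseteq> power_carrier L n \<and>
     (\<forall>x\<in>B. \<forall>y\<in>B. (\<forall>i<n. x i \<sqsubseteq> y i) \<or> (\<forall>i<n. y i \<sqsubseteq> x i))"

lemma power_chain_subset: "power_chain n B \<Longrightarrow> G \<subseteq> B \<Longrightarrow> power_chain n G"
  unfolding power_chain_def by blast

lemma power_chain_closed:
  assumes "power_chain n B" "x \<in> B" "y \<in> B"
  shows "power_meet L n x y \<in> B" "power_sqjoin L n x y \<in> B"
proof -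
  have "x \<in> power_carrier L n" "y \<in> power_carrier L n"
    and "(\<forall>i<n. x i \<sqsubseteq> y i) \<or> (\<forall>i<n. y i \<sqsubseteq> x i)"
    using assms unfolding power_chain_def by blast+
  then show "power_meet L n x y \<in> B" "power_sqjoin L n x y \<in> B"
    using assms(2,3) power_ops_comparable[of x n y] power_ops_comparable[of y n x] by metis+
qed

lemma subalgebra_power_chain: "power_chain n B \<Longrightarrow> subalgebra L n B"
  by (simp add: subalgebra_def power_chain_closed) (simp add: power_chain_def)

lemma generated_power_chain:
  assumes "power_chain n G"
  shows "generated L n G = G"
proof
  show "generated L n G \<subseteq> G"
  proof
    fix x assume "x \<in> generated L n G"
    then show "x \<in> G"
      by induction (auto intro: power_chain_closed[OF assms])
  qed
qed (auto intro: generated.base)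

lemma min_gen_power_chain:
  assumes "power_chain n B"
  shows "min_gen L n B = card B"
proof -
  \<comment> \<open>A generating set \<open>G\<close> lies in \<open>B\<close>, so it is again a
    chain and generates only itself; \<open>B \<subseteq> generated L n G\<close> then forces
    \<open>G = B\<close>.\<close>
  have "generating_set L n B G \<longleftrightarrow> G = B" for G
    using generated_power_chain[OF power_chain_subset[OF assms]]
    by (auto simp: generating_set_def)
  then have "{card G | G. generating_set L n B G} = {card B}"
    by auto
  then show ?thesis
    by (simp add: min_gen_def)
qed

lemma card_power_chain_le_max_gen:
  assumes "finite (carrier L)" "power_chain n B"
  shows "card B \<le> max_gen L n"
proof -
  have "finite (power_carrier L n)"
    using assms(1) by (auto simp: power_carrier_def intro: finite_PiE)
  \<comment> \<open>\<open>Max\<close> bounds its members only for a finite set; here finiteness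
    comes from the finitely many subsets of the power.\<close>
  moreover have "{min_gen L n B | B. subalgebra L n B} \<subseteq> min_gen L n ` Pow (power_carrier L n)"
    by (auto simp: subalgebra_def)
  ultimately have "finite {min_gen L n B | B. subalgebra L n B}"
    by (meson finite_Pow_iff finite_imageI finite_subset)
  moreover have "card B \<in> {min_gen L n B | B. subalgebra L n B}"
    using min_gen_power_chain[OF assms(2)] subalgebra_power_chain[OF assms(2)] by force
  ultimately show ?thesis
    by (simp add: max_gen_def)
qed

lemma max_gen_ge:
  assumes "finite (carrier L)" "a \<in> carrier L" "b \<in> carrier L" "a \<sqsubseteq> b" "a \<noteq> b"
  shows "Suc n \<le> max_gen L n"
proof -
  \<comment> \<open>Threshold tuples: \<open>b\<close> in the first \<open>k\<close> coordinates and
    \<open>a\<close> in the rest. The thresholds 0 to \<open>n\<close> give \<open>n + 1\<close>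
    tuples, increasing with \<open>k\<close>.\<close>
  define c where "c k = (\<lambda>i\<in>{..<n}. if i < k then b else a)" for k :: nat
  \<comment> \<open>Coordinate \<open>k\<close> separates them, with values \<open>a\<close> and
    \<open>b\<close>; it is a genuine index because \<open>k < l \<le> n\<close>.\<close>
  have "c k \<noteq> c l" if "k < l" "l \<le> n" for k l
  proof
    assume "c k = c l"
    then have "c k k = c l k" by simp
    with that \<open>a \<noteq> b\<close> show False by (simp add: c_def)
  qed
  then have "inj_on c {..n}"
    by (intro linorder_inj_onI) auto
  then have card: "card (c ` {..n}) = Suc n"
    by (simp add: card_image)
  have "(\<forall>i<n. c k i \<sqsubseteq> c l i) \<or> (\<forall>i<n. c l i \<sqsubseteq> c k i)" for k l
    using assms by (cases "k \<le> l") (auto simp: c_def)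
  moreover have "c k \<in> power_carrier L n" for k
    unfolding c_def power_carrier_def using assms(2,3) by (intro restrict_PiE_iff[THEN iffD2]) auto
  ultimately have "power_chain n (c ` {..n})"
    by (auto simp: power_chain_def)
  then show ?thesis
    using card_power_chain_le_max_gen[OF assms(1)] card by metis
qed

end

theorem theorem3p2:
  shows "\<exists>L :: nat gorder. finite_semilattice L \<and>
           (\<lambda>n. real (max_gen L n)) \<in> \<Omega>(\<lambda>n. real n)"
proof -
  define L :: "nat gorder" where "L = \<lparr>carrier = {0, 1}, eq = (=), le = (\<le>)\<rparr>"
  interpret partial_order L
    by unfold_locales (auto simp: L_def)
  \<comment> \<open>Totality supplies the binary meets needed for
    \<open>lower_semilattice\<close>.\<close>
  interpret total_order L
    by (rule total_orderI) (auto simp: L_def)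
  have "lower_semilattice L" ..
  then have "finite_semilattice L"
    by (simp add: finite_semilattice_def L_def)
  moreover have "n \<le> max_gen L n" for n
    using max_gen_ge[of 0 1 n] by (simp add: L_def)
  then have "(\<lambda>n. real (max_gen L n)) \<in> \<Omega>(\<lambda>n. real n)"
    by (intro landau_omega.bigI[of 1]) auto
  ultimately show ?thesis
    by blast
qed

end
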